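(* Let $n$ be a positive integer, let $A=\mathbb{Z}[t_1^{\pm 1},\dots,t_n^{\pm 1},s_1^{\pm 1},\dots,s_n^{\pm 1}]$ be the ring of Laurent polynomials in $2n$ commuting variables, and let $V$ be the free $A$-module with basis $\{x_{ij}\mid i,j\in\{1,\dots,n\},\ i\neq j\}$. For pairwise distinct $i,j,k\in\{1,\dots,n\}$ let $\rho_{ijk}\in \mathrm{End}_A(V)$ be the $A$-linear endomorphism defined on the basis by $$\rho_{ijk}(x_{pq})=\begin{cases} t_i x_{ij}+(1-t_i)x_{ik}, & (p,q)=(i,j),\\ t_k^{-1}x_{kj}+(1-t_k^{-1})x_{ki}, & (p,q)=(k,j),\\ s_j x_{jk}, & (p,q)=(j,k),\\ s_j^{-1}x_{ji}, & (p,q)=(j,i),\\ x_{pq}, & \text{otherwise.}\end{cases}$$ Then the map $a_{ijk}\mapsto\rho_{ijk}$ on generators defines a representation of the group $\hat G^3_n$ on $V$, that is, it extends to a group homomorphism $\rho\colon \hat G^3_n\to \mathrm{Aut}_A(V)\subset \mathrm{End}_A(V)$.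
   Context: The group $\hat G^3_n$ is the group with generators $a_{ijk}$, one for each ordered triple of pairwise distinct numbers $i,j,k\in\{1,\dots,n\}$, and the relations: 1. $a_{kji}=a_{ijk}^{-1}$ for all pairwise distinct $i,j,k$; 2. $a_{ijk}a_{pqr}=a_{pqr}a_{ijk}$ whenever there are at least 5 different numbers among $i,j,k,p,q,r$; 3. $a_{ijk}a_{ijl}a_{ikl}a_{jkl}=a_{jkl}a_{ikl}a_{ijl}a_{ijk}$ for all pairwise distinct $i,j,k,l$. *)

theory Defs
  imports "HOL-Algebra.Group" "HOL-Algebra.Module" "HOL-Algebra.Bij" "HOL-Library.Poly_Mapping"
begin

section \<open>Groups given by generators and relations\<close>

text \<open>
  A word is a list of letters; the letter \<open>(g, True)\<close> stands for the generator \<open>g\<close> and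
  \<open>(g, False)\<close> for its formal inverse.  A relation \<open>u = v\<close> is given as the pair \<open>(u, v)\<close>.
\<close>

type_synonym 'g word = "('g \<times> bool) list"

definition words :: "'g set \<Rightarrow> 'g word set" where
  "words S = lists (S \<times> UNIV)"

inductive_set word_rel :: "'g set \<Rightarrow> ('g word \<times> 'g word) set \<Rightarrow> ('g word \<times> 'g word) set"
  for S :: "'g set" and R :: "('g word \<times> 'g word) set"
where
  refl: "w \<in> words S \<Longrightarrow> (w, w) \<in> word_rel S R"
| sym: "(u, v) \<in> word_rel S R \<Longrightarrow> (v, u) \<in> word_rel S R"
| trans: "(u, v) \<in> word_rel S R \<Longrightarrow> (v, w) \<in> word_rel S R \<Longrightarrow> (u, w) \<in> word_rel S R"
| compat: "(u, v) \<in> word_rel S R \<Longrightarrow> x \<in> words S \<Longrightarrow> y \<in> words S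
     \<Longrightarrow> (x @ u @ y, x @ v @ y) \<in> word_rel S R"
| cancel: "g \<in> S \<Longrightarrow> ([(g, b), (g, \<not> b)], []) \<in> word_rel S R"
| relator: "(u, v) \<in> R \<Longrightarrow> u \<in> words S \<Longrightarrow> v \<in> words S \<Longrightarrow> (u, v) \<in> word_rel S R"

definition word_class :: "'g set \<Rightarrow> ('g word \<times> 'g word) set \<Rightarrow> 'g word \<Rightarrow> 'g word set" where
  "word_class S R w = word_rel S R `` {w}"

definition presented_group :: "'g set \<Rightarrow> ('g word \<times> 'g word) set \<Rightarrow> 'g word set monoid" where
  "presented_group S R =
    \<lparr>carrier = words S // word_rel S R,
     mult = (\<lambda>P Q. \<Union>u\<in>P. \<Union>v\<in>Q. word_class S R (u @ v)),
     one = word_class S R []\<rparr>"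

definition presented_gen :: "'g set \<Rightarrow> ('g word \<times> 'g word) set \<Rightarrow> 'g \<Rightarrow> 'g word set" where
  "presented_gen S R g = word_class S R [(g, True)]"


section \<open>The group $\hat G^3_n$\<close>

type_synonym triple = "nat \<times> nat \<times> nat"

definition G3_gens :: "nat \<Rightarrow> triple set" where
  "G3_gens n = {(i, j, k). {i, j, k} \<subseteq> {1..n} \<and> distinct [i, j, k]}"

definition G3_rels :: "nat \<Rightarrow> (triple word \<times> triple word) set" where
  "G3_rels n =
     {([((k, j, i), True)], [((i, j, k), False)]) | i j k.
        (i, j, k) \<in> G3_gens n}
   \<union> {([((i, j, k), True), ((p, q, r), True)], [((p, q, r), True), ((i, j, k), True)]) | i j k p q r.
        (i, j, k) \<in> G3_gens n \<and> (p, q, r) \<in> G3_gens n \<and> card {i, j, k, p, q, r} \<ge> 5}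
   \<union> {([((i, j, k), True), ((i, j, l), True), ((i, k, l), True), ((j, k, l), True)],
       [((j, k, l), True), ((i, k, l), True), ((i, j, l), True), ((i, j, k), True)]) | i j k l.
        {i, j, k, l} \<subseteq> {1..n} \<and> distinct [i, j, k, l]}"

definition G3_hat :: "nat \<Rightarrow> triple word set monoid" where
  "G3_hat n = presented_group (G3_gens n) (G3_rels n)"

definition G3_gen :: "nat \<Rightarrow> triple \<Rightarrow> triple word set" where
  "G3_gen n = presented_gen (G3_gens n) (G3_rels n)"


section \<open>Laurent polynomials\<close>

text \<open>
  A Laurent monomial is a finitely supported map from variables to integer exponents, and a Laurent
  polynomial is a finitely supported map from Laurent monomials to integer coefficients.  The product
  of \<open>Poly_Mapping\<close> is convolution, so the type is the integral group ring of the free abelian group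
  on \<open>'v\<close>.  The ring of Laurent polynomials in the variables \<open>X\<close> is the subring of
  those elements in which only variables from \<open>X\<close> occur.
\<close>

type_synonym 'v laurent = "('v \<Rightarrow>\<^sub>0 int) \<Rightarrow>\<^sub>0 int"

definition laurent_ring :: "'v set \<Rightarrow> 'v laurent ring" where
  "laurent_ring X =
    \<lparr>carrier = {f. \<forall>m \<in> Poly_Mapping.keys f. Poly_Mapping.keys m \<subseteq> X},
     mult = (*), one = 1, zero = 0, add = (+)\<rparr>"

definition var_pow :: "'v \<Rightarrow> int \<Rightarrow> 'v laurent" where
  "var_pow x e = Poly_Mapping.single (Poly_Mapping.single x e) 1"

lemma var_pow_add: "var_pow x (d + e) = var_pow x d * var_pow x e"
  by (simp add: var_pow_def mult_single single_add)

lemma var_pow_0: "var_pow x 0 = 1"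
  by (simp add: var_pow_def)

lemma var_pow_closed: "x \<in> X \<Longrightarrow> var_pow x e \<in> carrier (laurent_ring X)"
  by (auto simp: var_pow_def laurent_ring_def)


section \<open>Free modules and linear automorphisms\<close>

definition scale :: "'v laurent \<Rightarrow> ('b \<Rightarrow>\<^sub>0 'v laurent) \<Rightarrow> ('b \<Rightarrow>\<^sub>0 'v laurent)" where
  "scale a v = Poly_Mapping.map ((*) a) v"

text \<open>
  The free module with basis \<open>B\<close> over \<open>laurent_ring X\<close>.  The record type of
  \<^locale>\<open>module\<close> extends that of rings; its fields \<open>mult\<close> and \<open>one\<close> play no role for modules.
\<close>

definition free_module :: "'v set \<Rightarrow> 'b set \<Rightarrow> ('v laurent, 'b \<Rightarrow>\<^sub>0 'v laurent) module" where
  "free_module X B =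
    \<lparr>carrier = {v. Poly_Mapping.keys v \<subseteq> B \<and>
                   (\<forall>b. Poly_Mapping.lookup v b \<in> carrier (laurent_ring X))},
     mult = undefined, one = undefined, zero = 0, add = (+), smult = scale\<rparr>"

definition basis_vec :: "'b \<Rightarrow> ('b \<Rightarrow>\<^sub>0 'v laurent)" where
  "basis_vec b = Poly_Mapping.single b 1"

definition linear_extension ::
    "('b \<Rightarrow> ('c \<Rightarrow>\<^sub>0 'v laurent)) \<Rightarrow> ('b \<Rightarrow>\<^sub>0 'v laurent) \<Rightarrow> ('c \<Rightarrow>\<^sub>0 'v laurent)" where
  "linear_extension F v = (\<Sum>b\<in>Poly_Mapping.keys v. scale (Poly_Mapping.lookup v b) (F b))"

definition module_End :: "('a, 'm) ring_scheme \<Rightarrow> ('a, 'b, 'n) module_scheme \<Rightarrow> ('b \<Rightarrow> 'b) set" where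
  "module_End R M =
    {f \<in> carrier M \<rightarrow>\<^sub>E carrier M.
       (\<forall>x\<in>carrier M. \<forall>y\<in>carrier M. f (x \<oplus>\<^bsub>M\<^esub> y) = f x \<oplus>\<^bsub>M\<^esub> f y) \<and>
       (\<forall>a\<in>carrier R. \<forall>x\<in>carrier M. f (a \<odot>\<^bsub>M\<^esub> x) = a \<odot>\<^bsub>M\<^esub> f x)}"

definition module_Aut :: "('a, 'm) ring_scheme \<Rightarrow> ('a, 'b, 'n) module_scheme \<Rightarrow> ('b \<Rightarrow> 'b) monoid" where
  "module_Aut R M = BijGroup (carrier M) \<lparr>carrier := module_End R M \<inter> Bij (carrier M)\<rparr>"


section \<open>The module $V$ and the endomorphisms $\rho_{ijk}$\<close>

datatype ts_var = T nat | S nat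

definition ts_vars :: "nat \<Rightarrow> ts_var set" where
  "ts_vars n = T ` {1..n} \<union> S ` {1..n}"

definition A_ring :: "nat \<Rightarrow> ts_var laurent ring" where
  "A_ring n = laurent_ring (ts_vars n)"

definition V_basis :: "nat \<Rightarrow> (nat \<times> nat) set" where
  "V_basis n = {(i, j). i \<in> {1..n} \<and> j \<in> {1..n} \<and> i \<noteq> j}"

type_synonym V_vec = "(nat \<times> nat) \<Rightarrow>\<^sub>0 ts_var laurent"

definition V_module :: "nat \<Rightarrow> (ts_var laurent, V_vec) module" where
  "V_module n = free_module (ts_vars n) (V_basis n)"

abbreviation t_pow :: "nat \<Rightarrow> int \<Rightarrow> ts_var laurent" where
  "t_pow i e \<equiv> var_pow (T i) e"

abbreviation s_pow :: "nat \<Rightarrow> int \<Rightarrow> ts_var laurent" where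
  "s_pow i e \<equiv> var_pow (S i) e"

abbreviation x_vec :: "nat \<Rightarrow> nat \<Rightarrow> V_vec" where
  "x_vec p q \<equiv> basis_vec (p, q)"

definition rho_on_basis :: "nat \<Rightarrow> nat \<Rightarrow> nat \<Rightarrow> nat \<times> nat \<Rightarrow> V_vec" where
  "rho_on_basis i j k = (\<lambda>(p, q).
     if (p, q) = (i, j) then scale (t_pow i 1) (x_vec i j) + scale (1 - t_pow i 1) (x_vec i k)
     else if (p, q) = (k, j) then scale (t_pow k (-1)) (x_vec k j) + scale (1 - t_pow k (-1)) (x_vec k i)
     else if (p, q) = (j, k) then scale (s_pow j 1) (x_vec j k)
     else if (p, q) = (j, i) then scale (s_pow j (-1)) (x_vec j i)
     else x_vec p q)"

definition rho :: "nat \<Rightarrow> nat \<Rightarrow> nat \<Rightarrow> nat \<Rightarrow> V_vec \<Rightarrow> V_vec" where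
  "rho n i j k = restrict (linear_extension (rho_on_basis i j k)) (carrier (V_module n))"


section \<open>Well-definedness\<close>

lemma laurent_ring_simps [simp]:
  "mult (laurent_ring X) = (*)" "one (laurent_ring X) = 1"
  "zero (laurent_ring X) = 0" "add (laurent_ring X) = (+)"
  by (simp_all add: laurent_ring_def)

lemma free_module_simps [simp]:
  "zero (free_module X B) = 0" "add (free_module X B) = (+)" "smult (free_module X B) = scale"
  by (simp_all add: free_module_def)

lemma laurent_zero_closed: "0 \<in> carrier (laurent_ring X)"
  and laurent_one_closed: "1 \<in> carrier (laurent_ring X)"
  by (auto simp: laurent_ring_def)

lemma laurent_add_closed:
  assumes "f \<in> carrier (laurent_ring X)" "g \<in> carrier (laurent_ring X)"
  shows "f + g \<in> carrier (laurent_ring X)"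
  using assms Poly_Mapping.keys_add[of f g] by (fastforce simp: laurent_ring_def)

lemma laurent_uminus_closed:
  assumes "f \<in> carrier (laurent_ring X)"
  shows "- f \<in> carrier (laurent_ring X)"
  using assms by (auto simp: laurent_ring_def)

lemma laurent_mult_closed:
  assumes "f \<in> carrier (laurent_ring X)" "g \<in> carrier (laurent_ring X)"
  shows "f * g \<in> carrier (laurent_ring X)"
  unfolding laurent_ring_def
proof (simp, intro ballI)
  fix m assume "m \<in> Poly_Mapping.keys (f * g)"
  then obtain a b where ab: "a \<in> Poly_Mapping.keys f" "b \<in> Poly_Mapping.keys g" "m = a + b"
    using keys_mult[of f g] by auto
  then have "Poly_Mapping.keys a \<subseteq> X" "Poly_Mapping.keys b \<subseteq> X"
    using assms by (auto simp: laurent_ring_def)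
  then show "Poly_Mapping.keys m \<subseteq> X"
    using Poly_Mapping.keys_add[of a b] ab(3) by blast
qed

lemma cring_laurent_ring: "cring (laurent_ring X)"
proof (rule cringI)
  show "abelian_group (laurent_ring X)"
  proof (rule abelian_groupI)
    fix x assume "x \<in> carrier (laurent_ring X)"
    then show "\<exists>y\<in>carrier (laurent_ring X). y \<oplus>\<^bsub>laurent_ring X\<^esub> x = \<zero>\<^bsub>laurent_ring X\<^esub>"
      by (intro bexI[of _ "- x"]) (auto simp: laurent_uminus_closed)
  qed (auto simp: laurent_add_closed laurent_zero_closed algebra_simps)
  show "comm_monoid (laurent_ring X)"
    by (rule comm_monoidI) (auto simp: laurent_mult_closed laurent_one_closed algebra_simps)
qed (auto simp: algebra_simps)

lemma lookup_scale [simp]: "Poly_Mapping.lookup (scale a v) b = a * Poly_Mapping.lookup v b"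
  by (simp add: scale_def Poly_Mapping.map.rep_eq when_def)

lemma in_free_module_iff:
  "v \<in> carrier (free_module X B) \<longleftrightarrow>
     (\<forall>b. Poly_Mapping.lookup v b \<in> carrier (laurent_ring X)) \<and>
     (\<forall>b. b \<notin> B \<longrightarrow> Poly_Mapping.lookup v b = 0)"
  by (auto simp: free_module_def in_keys_iff)

lemma module_free_module: "module (laurent_ring X) (free_module X B)"
proof (rule moduleI)
  show "abelian_group (free_module X B)"
  proof (rule abelian_groupI)
    fix x assume "x \<in> carrier (free_module X B)"
    then show "\<exists>y\<in>carrier (free_module X B). y \<oplus>\<^bsub>free_module X B\<^esub> x = \<zero>\<^bsub>free_module X B\<^esub>"
      by (intro bexI[of _ "- x"]) (auto simp: in_free_module_iff laurent_uminus_closed)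
  qed (auto simp: in_free_module_iff lookup_add laurent_add_closed laurent_zero_closed algebra_simps)
qed (auto simp: cring_laurent_ring in_free_module_iff laurent_mult_closed lookup_add
          intro!: poly_mapping_eqI simp: algebra_simps)

lemma lookup_linear_extension:
  assumes "finite K" "Poly_Mapping.keys v \<subseteq> K"
  shows "Poly_Mapping.lookup (linear_extension F v) c
       = (\<Sum>b\<in>K. Poly_Mapping.lookup v b * Poly_Mapping.lookup (F b) c)"
  unfolding linear_extension_def lookup_sum lookup_scale
  by (rule sum.mono_neutral_left) (use assms in \<open>auto simp: in_keys_iff\<close>)

lemma linear_extension_add:
  "linear_extension F (v + w) = linear_extension F v + linear_extension F w"
proof (rule poly_mapping_eqI)
  fix c
  let ?K = "Poly_Mapping.keys v \<union> Poly_Mapping.keys w"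
  have "Poly_Mapping.keys (v + w) \<subseteq> ?K"
    by (rule Poly_Mapping.keys_add)
  then show "Poly_Mapping.lookup (linear_extension F (v + w)) c
      = Poly_Mapping.lookup (linear_extension F v + linear_extension F w) c"
    by (simp add: lookup_linear_extension[where K = ?K] lookup_add distrib_right sum.distrib)
qed

lemma linear_extension_scale:
  "linear_extension F (scale a v) = scale a (linear_extension F v)"
proof (rule poly_mapping_eqI)
  fix c
  have "Poly_Mapping.keys (scale a v) \<subseteq> Poly_Mapping.keys v"
    by (auto simp: in_keys_iff)
  then show "Poly_Mapping.lookup (linear_extension F (scale a v)) c
      = Poly_Mapping.lookup (scale a (linear_extension F v)) c"
    by (simp add: lookup_linear_extension[where K = "Poly_Mapping.keys v"] sum_distrib_left mult.assoc)
qed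

lemma linear_extension_basis: "linear_extension F (basis_vec b) = F b"
  by (rule poly_mapping_eqI)
     (simp add: lookup_linear_extension[where K = "{b}"] basis_vec_def)

lemma linear_extension_closed:
  assumes v: "v \<in> carrier (free_module X B)"
    and F: "\<And>b. b \<in> B \<Longrightarrow> F b \<in> carrier (free_module X C)"
  shows "linear_extension F v \<in> carrier (free_module X C)"
proof -
  interpret M: module "laurent_ring X" "free_module X C"
    by (rule module_free_module)
  have "(\<Sum>b\<in>K. scale (Poly_Mapping.lookup v b) (F b)) \<in> carrier (free_module X C)"
    if "finite K" "K \<subseteq> B" for K
    using that
  proof induction
    case empty
    then show ?case using M.M.zero_closed by simp
  next
    case (insert b K)
    have "scale (Poly_Mapping.lookup v b) (F b) \<in> carrier (free_module X C)"
      using M.smult_closed[of "Poly_Mapping.lookup v b" "F b"] F[of b] v insert.prems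
      by (auto simp: in_free_module_iff)
    then show ?case
      using M.M.add.m_closed insert by simp
  qed
  then show ?thesis
    using v by (simp add: linear_extension_def free_module_def)
qed

lemma basis_vec_closed: "b \<in> B \<Longrightarrow> basis_vec b \<in> carrier (free_module X B)"
  by (auto simp: in_free_module_iff basis_vec_def lookup_single when_def
        laurent_zero_closed laurent_one_closed)

lemma rho_basis:
  "(p, q) \<in> V_basis n \<Longrightarrow> rho n i j k (x_vec p q) = rho_on_basis i j k (p, q)"
  by (simp add: rho_def V_module_def basis_vec_closed linear_extension_basis)

lemma rho_in_End:
  assumes "(i, j, k) \<in> G3_gens n"
  shows "rho n i j k \<in> module_End (A_ring n) (V_module n)"
proof -
  interpret M: module "laurent_ring (ts_vars n)" "V_module n"
    unfolding V_module_def by (rule module_free_module)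
  have V: "add (V_module n) = (+)" "smult (V_module n) = scale"
    by (simp_all add: V_module_def)
  have vars: "T i \<in> ts_vars n" "T k \<in> ts_vars n" "S j \<in> ts_vars n"
    using assms by (auto simp: G3_gens_def ts_vars_def)
  have coeff: "var_pow x e \<in> carrier (laurent_ring (ts_vars n))"
      "1 - var_pow x e \<in> carrier (laurent_ring (ts_vars n))" if "x \<in> ts_vars n" for x e
    using laurent_add_closed[OF laurent_one_closed laurent_uminus_closed[OF var_pow_closed[OF that]]]
    by (simp_all add: that var_pow_closed)
  have x: "x_vec p q \<in> carrier (V_module n)" if "(p, q) \<in> V_basis n" for p q
    unfolding V_module_def by (rule basis_vec_closed[OF that])
  have basis: "(i, j) \<in> V_basis n" "(i, k) \<in> V_basis n" "(k, j) \<in> V_basis n"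
      "(k, i) \<in> V_basis n" "(j, k) \<in> V_basis n" "(j, i) \<in> V_basis n"
    using assms by (auto simp: G3_gens_def V_basis_def)
  have F: "rho_on_basis i j k b \<in> carrier (V_module n)" if "b \<in> V_basis n" for b
    using that M.M.add.m_closed M.smult_closed x basis coeff vars
    by (auto simp: rho_on_basis_def V split: prod.splits)
  have closed: "linear_extension (rho_on_basis i j k) v \<in> carrier (V_module n)"
    if "v \<in> carrier (V_module n)" for v
    unfolding V_module_def
    by (rule linear_extension_closed) (use that F in \<open>auto simp: V_module_def\<close>)
  show ?thesis
    using closed M.M.add.m_closed M.smult_closed
    by (auto simp: module_End_def rho_def A_ring_def V linear_extension_add linear_extension_scale)
qed

end

theory Submission
  imports Defs
begin

text \<open>
  By the universal property of a presented group it suffices to verify the relations.  Every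
  \<open>\<rho>\<^sub>i\<^sub>j\<^sub>k\<close> is the restriction of a linear map defined on all finitely supported families, so
  the relations may be checked on basis vectors.  The map \<open>\<rho>\<^sub>i\<^sub>j\<^sub>k\<close> moves only vectors
  \<open>x\<^sub>p\<^sub>q\<close> with \<open>p, q \<in> {i, j, k}\<close> and preserves their span.  Two triples with at
  least five different entries share at most one index, so the corresponding maps act on disjoint
  parts of the basis.
\<close>

section \<open>Universal property of a presented group\<close>

lemma words_simps [simp]:
  "[] \<in> words X" "(g, b) # w \<in> words X \<longleftrightarrow> g \<in> X \<and> w \<in> words X"
  "u @ v \<in> words X \<longleftrightarrow> u \<in> words X \<and> v \<in> words X"
  by (auto simp: words_def)

lemma word_rel_words: "(u, v) \<in> word_rel X R \<Longrightarrow> u \<in> words X \<and> v \<in> words X"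
  by (induction rule: word_rel.induct) auto

lemma equiv_word_rel: "equiv (words X) (word_rel X R)"
proof (rule equivI)
  show "word_rel X R \<subseteq> words X \<times> words X"
    by (auto dest: word_rel_words)
  show "refl_on (words X) (word_rel X R)"
    by (simp add: refl_on_def word_rel.refl)
  show "sym (word_rel X R)"
    by (rule symI) (rule word_rel.sym)
  show "trans (word_rel X R)"
    by (rule transI) (rule word_rel.trans)
qed

text \<open>One factor is changed at a time, with \<open>u' @ v\<close> as the intermediate word;
  \<open>compat\<close> covers each change, the missing side of the context being the empty
  word.\<close>

lemma word_rel_append:
  assumes "(u, u') \<in> word_rel X R" "(v, v') \<in> word_rel X R"
  shows "(u @ v, u' @ v') \<in> word_rel X R"
proof -
  have "([] @ u @ v, [] @ u' @ v) \<in> word_rel X R" "(u' @ v @ [], u' @ v' @ []) \<in> word_rel X R"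
    using assms by (auto dest: word_rel_words intro!: word_rel.compat simp del: append_Nil append_Nil2)
  then show ?thesis
    by (auto intro: word_rel.trans[of _ "u' @ v"])
qed

lemma word_class_eq_iff:
  "u \<in> words X \<Longrightarrow> v \<in> words X \<Longrightarrow> word_class X R u = word_class X R v \<longleftrightarrow> (u, v) \<in> word_rel X R"
  unfolding word_class_def by (rule eq_equiv_class_iff[OF equiv_word_rel])

lemma carrier_presented_group: "carrier (presented_group X R) = word_class X R ` words X"
  by (auto simp: presented_group_def word_class_def quotient_def)

lemma one_presented_group: "\<one>\<^bsub>presented_group X R\<^esub> = word_class X R []"
  by (simp add: presented_group_def)

text \<open>The product is a union over all pairs of representatives. By the congruence property
  every set in this union is the same class, so any one pair computes it.\<close>

lemma mult_presented_group:
  assumes "u \<in> words X" "v \<in> words X"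
  shows "word_class X R u \<otimes>\<^bsub>presented_group X R\<^esub> word_class X R v = word_class X R (u @ v)"
proof -
  have "word_class X R (u' @ v') = word_class X R (u @ v)"
    if "u' \<in> word_class X R u" "v' \<in> word_class X R v" for u' v'
  proof -
    have "(u @ v, u' @ v') \<in> word_rel X R"
      using that by (simp add: word_class_def word_rel_append)
    then show ?thesis
      unfolding word_class_def by (rule equiv_class_eq[OF equiv_word_rel, symmetric])
  qed
  moreover have "u \<in> word_class X R u" "v \<in> word_class X R v"
    using assms by (simp_all add: word_class_def word_rel.refl)
  ultimately have "(\<Union>u'\<in>word_class X R u. \<Union>v'\<in>word_class X R v. word_class X R (u' @ v'))
      = word_class X R (u @ v)"
    by blast
  then show ?thesis
    by (simp add: presented_group_def)
qed

section \<open>Inverse words and the group axioms\<close>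

definition word_inverse :: "'g word \<Rightarrow> 'g word" where
  "word_inverse w = rev (map (\<lambda>(g, b). (g, \<not> b)) w)"

lemma word_inverse_words: "w \<in> words X \<Longrightarrow> word_inverse w \<in> words X"
  by (induction w) (auto simp: word_inverse_def)

text \<open>Induction from the inside out: the first letter of the word stands next to its own
  inverse in the middle, and removing this pair leaves the case of the tail. Left inverses are all
  that \<open>groupI\<close> asks for.\<close>

lemma word_inverse_cancel: "w \<in> words X \<Longrightarrow> (word_inverse w @ w, []) \<in> word_rel X R"
proof (induction w)
  case Nil
  then show ?case by (simp add: word_inverse_def word_rel.refl)
next
  case (Cons x w)
  obtain g b where x: "x = (g, b)" by (cases x)
  have "([(g, \<not> b), (g, \<not> \<not> b)], []) \<in> word_rel X R"
    using Cons.prems x by (intro word_rel.cancel) auto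
  then have "(word_inverse w @ [(g, \<not> b), (g, b)] @ w, word_inverse w @ [] @ w) \<in> word_rel X R"
    using Cons.prems x by (intro word_rel.compat) (auto simp: word_inverse_words)
  moreover have "(word_inverse w @ w, []) \<in> word_rel X R"
    using Cons x by simp
  ultimately have "(word_inverse w @ [(g, \<not> b), (g, b)] @ w, []) \<in> word_rel X R"
    by (simp add: word_rel.trans)
  then show ?case
    by (simp add: word_inverse_def x)
qed

lemma group_presented_group: "group (presented_group X R)"
proof (rule groupI)
  fix P Q assume "P \<in> carrier (presented_group X R)" "Q \<in> carrier (presented_group X R)"
  then show "P \<otimes>\<^bsub>presented_group X R\<^esub> Q \<in> carrier (presented_group X R)"
    unfolding carrier_presented_group by (elim imageE) (simp add: mult_presented_group)
next
  fix P assume "P \<in> carrier (presented_group X R)"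
  then obtain w where w: "w \<in> words X" "P = word_class X R w"
    by (auto simp: carrier_presented_group)
  then show "\<exists>Q\<in>carrier (presented_group X R). Q \<otimes>\<^bsub>presented_group X R\<^esub> P = \<one>\<^bsub>presented_group X R\<^esub>"
    by (intro bexI[of _ "word_class X R (word_inverse w)"])
       (auto simp: mult_presented_group one_presented_group carrier_presented_group
          word_inverse_words word_class_eq_iff word_inverse_cancel)
next
  show "\<one>\<^bsub>presented_group X R\<^esub> \<in> carrier (presented_group X R)"
    by (simp add: carrier_presented_group one_presented_group)
next
  fix P Q U assume "P \<in> carrier (presented_group X R)" "Q \<in> carrier (presented_group X R)"
    "U \<in> carrier (presented_group X R)"
  then show "P \<otimes>\<^bsub>presented_group X R\<^esub> Q \<otimes>\<^bsub>presented_group X R\<^esub> U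
      = P \<otimes>\<^bsub>presented_group X R\<^esub> (Q \<otimes>\<^bsub>presented_group X R\<^esub> U)"
    unfolding carrier_presented_group by (elim imageE) (simp add: mult_presented_group)
next
  fix P assume "P \<in> carrier (presented_group X R)"
  then show "\<one>\<^bsub>presented_group X R\<^esub> \<otimes>\<^bsub>presented_group X R\<^esub> P = P"
    unfolding carrier_presented_group
    by (elim imageE) (simp add: mult_presented_group one_presented_group)
qed

section \<open>Evaluation of words in a group\<close>

definition word_eval :: "('a, 'm) monoid_scheme \<Rightarrow> ('g \<Rightarrow> 'a) \<Rightarrow> 'g word \<Rightarrow> 'a" where
  "word_eval H f w = foldr (\<lambda>(g, b) h. (if b then f g else inv\<^bsub>H\<^esub> f g) \<otimes>\<^bsub>H\<^esub> h) w \<one>\<^bsub>H\<^esub>"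

lemma word_eval_simps [simp]:
  "word_eval H f [] = \<one>\<^bsub>H\<^esub>"
  "word_eval H f ((g, b) # w) = (if b then f g else inv\<^bsub>H\<^esub> f g) \<otimes>\<^bsub>H\<^esub> word_eval H f w"
  by (simp_all add: word_eval_def)

context group
begin

lemma word_eval_closed:
  "f \<in> X \<rightarrow> carrier G \<Longrightarrow> w \<in> words X \<Longrightarrow> word_eval G f w \<in> carrier G"
  by (induction w) (auto simp: Pi_iff)

lemma word_eval_append:
  assumes f: "f \<in> X \<rightarrow> carrier G" and "u \<in> words X" and v: "v \<in> words X"
  shows "word_eval G f (u @ v) = word_eval G f u \<otimes> word_eval G f v"
  using assms(2)
proof (induction u)
  case (Cons x u)
  obtain g b where x: "x = (g, b)" by (cases x)
  then have "f g \<in> carrier G" using Cons.prems f by auto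
  then show ?case
    using Cons x v by (simp add: word_eval_closed[OF f] m_assoc)
qed (simp add: v word_eval_closed[OF f])

text \<open>Induction on the derivation. Equality is itself an equivalence, multiplicativity handles
  contexts, inverses handle cancelling pairs, and the assumption on \<open>R\<close> handles the
  relators.\<close>

lemma word_eval_cong:
  assumes "(u, v) \<in> word_rel X R" and f: "f \<in> X \<rightarrow> carrier G"
    and R: "\<And>u v. (u, v) \<in> R \<Longrightarrow> word_eval G f u = word_eval G f v"
  shows "word_eval G f u = word_eval G f v"
  using assms(1)
proof (induction rule: word_rel.induct)
  case (compat u v x y)
  then show ?case
    using word_rel_words[OF compat.hyps(1)] f by (simp add: word_eval_append)
next
  case (cancel g b)
  then have "f g \<in> carrier G" using f by auto
  then show ?case by simp
next
  case (relator u v)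
  then show ?case by (intro R)
next
  case (trans u v w)
  show ?case using trans.IH by (rule HOL.trans)
next
  case (sym u v)
  show ?case using sym.IH by (rule HOL.sym)
qed (rule HOL.refl)

text \<open>Von Dyck's theorem: evaluation of words respects the congruence and therefore descends
  to classes.\<close>

theorem presented_group_universal:
  assumes f: "f \<in> X \<rightarrow> carrier G"
    and R: "\<And>u v. (u, v) \<in> R \<Longrightarrow> word_eval G f u = word_eval G f v"
  shows "\<exists>\<phi>. group_hom (presented_group X R) G \<phi> \<and> (\<forall>g\<in>X. \<phi> (presented_gen X R g) = f g)"
proof -
  \<comment> \<open>Evaluation is constant on a class, so its image there is a singleton and
    \<open>the_elem\<close> reads off the value without a choice of representative.\<close>
  define \<phi> where "\<phi> P = the_elem (word_eval G f ` P)" for P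
  have eval: "\<phi> (word_class X R w) = word_eval G f w" if "w \<in> words X" for w
  proof -
    have "w \<in> word_class X R w"
      using that by (simp add: word_class_def word_rel.refl)
    moreover have "word_eval G f v = word_eval G f w" if "v \<in> word_class X R w" for v
    proof -
      have "(w, v) \<in> word_rel X R"
        using that by (simp add: word_class_def)
      then show ?thesis
        using f R by (rule word_eval_cong[symmetric])
    qed
    ultimately show ?thesis
      unfolding \<phi>_def by (intro the_elem_image_unique) blast+
  qed
  have "\<phi> \<in> hom (presented_group X R) G"
    by (rule homI)
       (auto simp: carrier_presented_group mult_presented_group eval
         word_eval_closed[OF f] word_eval_append[OF f])
  then have "group_hom (presented_group X R) G \<phi>"
    by (intro group_hom.intro group_hom_axioms.intro group_presented_group is_group)
  moreover have "\<phi> (presented_gen X R g) = f g" if "g \<in> X" for g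
    using that f by (auto simp: presented_gen_def eval Pi_iff)
  ultimately show ?thesis by blast
qed

end

section \<open>The automorphism group of a module\<close>

text \<open>The point that needs an argument is that the inverse of a bijective linear map is
  linear.\<close>

lemma (in module) subgroup_module_Aut:
  "subgroup (module_End R M \<inter> Bij (carrier M)) (BijGroup (carrier M))"
proof (rule group.subgroupI[OF group_BijGroup])
  have "(\<lambda>x\<in>carrier M. x) \<in> module_End R M \<inter> Bij (carrier M)"
    using id_Bij by (auto simp: module_End_def)
  then show "module_End R M \<inter> Bij (carrier M) \<noteq> {}" by blast
next
  fix f assume f: "f \<in> module_End R M \<inter> Bij (carrier M)"
  then have bij: "bij_betw f (carrier M) (carrier M)"
    by (simp add: Bij_def)
  define g where "g = inv_into (carrier M) f"
  have g: "g x \<in> carrier M" "f (g x) = x" if "x \<in> carrier M" for x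
    using that bij unfolding g_def
    by (auto simp: bij_betw_def inv_into_into f_inv_into_f)
  \<comment> \<open>A value of \<open>g\<close> is recognised by applying \<open>f\<close> to the
    candidate, which reduces linearity of \<open>g\<close> to that of \<open>f\<close>.\<close>
  have gI: "g y = x" if "x \<in> carrier M" "f x = y" for x y
    using that bij unfolding g_def by (auto simp: bij_betw_def)
  \<comment> \<open>Endomorphisms are extensional functions, whereas \<open>inv_into\<close> is
    unspecified off the carrier; hence the restriction.\<close>
  have "restrict g (carrier M) \<in> module_End R M"
    using f g by (auto simp: module_End_def intro!: gI)
  moreover have "restrict g (carrier M) \<in> Bij (carrier M)"
    unfolding g_def by (rule restrict_inv_into_Bij) (use f in simp)
  ultimately show "inv\<^bsub>BijGroup (carrier M)\<^esub> f \<in> module_End R M \<inter> Bij (carrier M)"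
    using f by (simp add: inv_BijGroup g_def)
next
  fix f g assume fg: "f \<in> module_End R M \<inter> Bij (carrier M)" "g \<in> module_End R M \<inter> Bij (carrier M)"
  then have "compose (carrier M) f g \<in> module_End R M"
    by (auto simp: module_End_def compose_def PiE_iff)
  then show "f \<otimes>\<^bsub>BijGroup (carrier M)\<^esub> g \<in> module_End R M \<inter> Bij (carrier M)"
    using fg by (auto simp: BijGroup_def compose_Bij)
qed (auto simp: BijGroup_def)

lemma (in module) group_module_Aut: "group (module_Aut R M)"
  unfolding module_Aut_def
  by (rule subgroup.subgroup_is_group[OF subgroup_module_Aut group_BijGroup])

lemma carrier_module_Aut: "carrier (module_Aut R M) = module_End R M \<inter> Bij (carrier M)"
  by (simp add: module_Aut_def)

lemma one_module_Aut: "\<one>\<^bsub>module_Aut R M\<^esub> = (\<lambda>x\<in>carrier M. x)"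
  by (simp add: module_Aut_def BijGroup_def)

lemma mult_module_Aut:
  "f \<in> Bij (carrier M) \<Longrightarrow> g \<in> Bij (carrier M)
    \<Longrightarrow> f \<otimes>\<^bsub>module_Aut R M\<^esub> g = compose (carrier M) f g"
  by (simp add: module_Aut_def BijGroup_def)

section \<open>Relations between the linear maps\<close>

lemma linear_extension_0: "linear_extension F 0 = 0"
  by (simp add: linear_extension_def)

lemma linear_extension_sum:
  "linear_extension F (\<Sum>b\<in>K. h b) = (\<Sum>b\<in>K. linear_extension F (h b))"
  by (induction K rule: infinite_finite_induct)
     (simp_all add: linear_extension_0 linear_extension_add)

text \<open>This is what reduces an identity between composites to basis vectors. Linear extensions
  act on all finitely supported families, so no membership conditions arise.\<close>

lemma linear_extension_compose:
  "linear_extension F (linear_extension G v) = linear_extension (\<lambda>b. linear_extension F (G b)) v"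
  unfolding linear_extension_def[of G] linear_extension_def[of "\<lambda>b. linear_extension F (G b)"]
  by (simp add: linear_extension_sum linear_extension_scale)

lemma linear_extension_basis_vec: "linear_extension basis_vec v = v"
proof (rule poly_mapping_eqI)
  fix c
  \<comment> \<open>Adding \<open>c\<close> keeps it in the index set even when its coefficient in
    \<open>v\<close> is zero.\<close>
  define K where "K = insert c (Poly_Mapping.keys v)"
  have K: "finite K" "Poly_Mapping.keys v \<subseteq> K" "c \<in> K"
    by (auto simp: K_def)
  have "Poly_Mapping.lookup (linear_extension basis_vec v) c
      = (\<Sum>b\<in>K. if b = c then Poly_Mapping.lookup v b else 0)"
    unfolding lookup_linear_extension[OF K(1,2)]
    by (rule sum.cong) (simp_all add: basis_vec_def lookup_single when_def)
  also have "\<dots> = Poly_Mapping.lookup v c"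
    using K by simp
  finally show "Poly_Mapping.lookup (linear_extension basis_vec v) c = Poly_Mapping.lookup v c" .
qed

section \<open>Inverses, far commutativity and the tetrahedron relation\<close>

abbreviation rho_lin :: "nat \<Rightarrow> nat \<Rightarrow> nat \<Rightarrow> V_vec \<Rightarrow> V_vec" where
  "rho_lin i j k \<equiv> linear_extension (rho_on_basis i j k)"

lemma rho_lin_basis:
  "rho_lin i j k (x_vec p q) =
    (if p = i \<and> q = j then scale (t_pow i 1) (x_vec i j) + scale (1 - t_pow i 1) (x_vec i k)
     else if p = k \<and> q = j then scale (t_pow k (-1)) (x_vec k j) + scale (1 - t_pow k (-1)) (x_vec k i)
     else if p = j \<and> q = k then scale (s_pow j 1) (x_vec j k)
     else if p = j \<and> q = i then scale (s_pow j (-1)) (x_vec j i)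
     else x_vec p q)"
  unfolding linear_extension_basis by (simp add: rho_on_basis_def)

lemma rho_lin_fixes:
  "p \<notin> {i, j, k} \<or> q \<notin> {i, j, k} \<Longrightarrow> rho_lin i j k (x_vec p q) = x_vec p q"
  by (elim disjE) (simp_all add: rho_lin_basis)

lemma scale_simps:
  "scale a (scale b v) = scale (a * b) v" "scale 1 v = v"
  by (rule poly_mapping_eqI, simp add: mult.assoc)+

lemma var_pow_inverse [simp]:
  "var_pow x 1 * var_pow x (-1) = 1" "var_pow x (-1) * var_pow x 1 = 1"
  by (simp_all add: var_pow_0 flip: var_pow_add)

lemma rho_lin_eqI:
  assumes "\<And>p q. rho_lin i j k (rho_lin i' j' k' (x_vec p q)) = x_vec p q"
  shows "rho_lin i j k (rho_lin i' j' k' v) = v"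
proof -
  have "rho_lin i j k (rho_on_basis i' j' k' b) = basis_vec b" for b
    using assms[of "fst b" "snd b"] by (simp add: linear_extension_basis)
  then show ?thesis
    by (simp add: linear_extension_compose linear_extension_basis_vec)
qed

text \<open>Exchanging \<open>i\<close> and \<open>k\<close> replaces each of the parameters
  \<open>t_i\<close>, \<open>t_k\<close>, \<open>s_j\<close> by its inverse in the formulas, while
  \<open>x_ik\<close> and \<open>x_ki\<close> are fixed by both maps.\<close>

lemma rho_lin_inverse:
  assumes "distinct [i, j, k]"
  shows "rho_lin k j i (rho_lin i j k v) = v"
proof (rule rho_lin_eqI)
  fix p q
  \<comment> \<open>The computation for \<open>x_ij\<close> and \<open>x_kj\<close>:
    \<open>v\<close> is this vector, \<open>w\<close> is the fixed vector \<open>x_ik\<close> or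
    \<open>x_ki\<close>, and \<open>u\<close>, \<open>u'\<close> are the mutually inverse powers of
    \<open>t_i\<close> or \<open>t_k\<close>.\<close>
  have "scale u (scale u' v + scale (1 - u') w) + scale (1 - u) w = v"
    if "u * u' = 1" for u u' :: "ts_var laurent" and v w :: V_vec
  proof -
    have "u * (u' * a + (1 - u') * b) + (1 - u) * b = (u * u') * a + (1 - u * u') * b" for a b
      by (simp add: algebra_simps)
    then show ?thesis
      using that by (intro poly_mapping_eqI) (simp add: lookup_add)
  qed
  then show "rho_lin k j i (rho_lin i j k (x_vec p q)) = x_vec p q"
    using assms by (auto simp: rho_lin_basis linear_extension_add linear_extension_scale scale_simps)
qed

text \<open>The vectors \<open>x_aa\<close> lie outside V, but identities are checked on all index
  pairs, so the diagonal has to be covered too.\<close>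

lemma rho_lin_fixes_diagonal:
  "distinct [i, j, k] \<Longrightarrow> rho_lin i j k (x_vec a a) = x_vec a a"
  by (subst rho_lin_basis) auto

text \<open>The image of \<open>x_ab\<close> under the first map is a combination of off-diagonal
  vectors with indices in \<open>{i, j, k}\<close>. The second map fixes all of these, so both sides
  equal that image.\<close>

lemma rho_lin_commute_basis:
  assumes "distinct [i, j, k]" "{a, b} \<subseteq> {i, j, k}" "a \<noteq> b"
    and disj: "\<And>c d. c \<noteq> d \<Longrightarrow> {c, d} \<subseteq> {i, j, k} \<Longrightarrow> \<not> {c, d} \<subseteq> {p, q, r}"
  shows "rho_lin p q r (rho_lin i j k (x_vec a b)) = rho_lin i j k (rho_lin p q r (x_vec a b))"
proof -
  have fixed: "rho_lin p q r (x_vec c d) = x_vec c d" if "c \<noteq> d" "{c, d} \<subseteq> {i, j, k}" for c d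
    using disj[OF that] by (intro rho_lin_fixes) simp
  have "rho_lin p q r (rho_lin i j k (x_vec a b)) = rho_lin i j k (x_vec a b)"
    using assms(1-3) by (simp add: rho_lin_basis[of i j k] linear_extension_add linear_extension_scale fixed)
  then show ?thesis
    using fixed[OF assms(3,2)] by simp
qed

lemma rho_lin_commute:
  assumes "distinct [i, j, k]" "distinct [p, q, r]" and card: "card {i, j, k, p, q, r} \<ge> 5"
  shows "rho_lin i j k (rho_lin p q r v) = rho_lin p q r (rho_lin i j k v)"
proof -
  \<comment> \<open>Two triples of three elements whose union has at least five share at most one
    element, so they cannot share a pair.\<close>
  have disj: "\<not> {a, b} \<subseteq> {p, q, r}" if "a \<noteq> b" "{a, b} \<subseteq> {i, j, k}" for a b
  proof
    assume "{a, b} \<subseteq> {p, q, r}"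
    then have "card {a, b} \<le> card ({i, j, k} \<inter> {p, q, r})"
      using that(2) by (intro card_mono Int_greatest) simp_all
    moreover have "card {i, j, k} + card {p, q, r}
        = card ({i, j, k} \<union> {p, q, r}) + card ({i, j, k} \<inter> {p, q, r})"
      by (rule card_Un_Int) simp_all
    moreover have "card ({i, j, k} \<union> {p, q, r}) = card {i, j, k, p, q, r}"
      by (rule arg_cong[where f = card]) blast
    moreover have "card {a, b} = 2" "card {i, j, k} = 3" "card {p, q, r} = 3"
      using assms(1,2) that(1) by simp_all
    ultimately show False
      using card by linarith
  qed
  have "rho_lin i j k (rho_lin p q r (x_vec a b)) = rho_lin p q r (rho_lin i j k (x_vec a b))" for a b
  proof -
    consider "a = b" | "a \<noteq> b" "{a, b} \<subseteq> {i, j, k}" | "a \<noteq> b" "{a, b} \<subseteq> {p, q, r}"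
      | "\<not> {a, b} \<subseteq> {i, j, k}" "\<not> {a, b} \<subseteq> {p, q, r}"
      by blast
    then show ?thesis
    proof cases
      case 1
      then show ?thesis using assms by (simp add: rho_lin_fixes_diagonal)
    next
      case 2
      with assms(1) disj show ?thesis by (intro rho_lin_commute_basis[symmetric])
    next
      case 3
      have "\<not> {c, d} \<subseteq> {i, j, k}" if "c \<noteq> d" "{c, d} \<subseteq> {p, q, r}" for c d
        using disj that by blast
      with assms(2) 3 show ?thesis by (intro rho_lin_commute_basis)
    next
      case 4
      then have "rho_lin i j k (x_vec a b) = x_vec a b" "rho_lin p q r (x_vec a b) = x_vec a b"
        by (simp_all add: rho_lin_fixes)
      then show ?thesis by simp
    qed
  qed
  then have "rho_lin i j k (rho_on_basis p q r b) = rho_lin p q r (rho_on_basis i j k b)" for b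
    by (cases b) (simp add: linear_extension_basis)
  then show ?thesis
    by (simp add: linear_extension_compose)
qed

text \<open>The six off-diagonal vectors of a triple as separate rewrite rules, so that long
  composites are evaluated without case splits.\<close>

lemma rho_lin_triple_basis:
  assumes "distinct [i, j, k]"
  shows "rho_lin i j k (x_vec i j) = scale (t_pow i 1) (x_vec i j) + scale (1 - t_pow i 1) (x_vec i k)"
    "rho_lin i j k (x_vec k j) = scale (t_pow k (-1)) (x_vec k j) + scale (1 - t_pow k (-1)) (x_vec k i)"
    "rho_lin i j k (x_vec j k) = scale (s_pow j 1) (x_vec j k)"
    "rho_lin i j k (x_vec j i) = scale (s_pow j (-1)) (x_vec j i)"
    "rho_lin i j k (x_vec i k) = x_vec i k"
    "rho_lin i j k (x_vec k i) = x_vec k i"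
  using assms by (simp_all add: rho_lin_basis)

text \<open>Direct evaluation on the sixteen vectors with both indices in
  \<open>{i, j, k, l}\<close>; all other basis vectors are fixed by the four maps.\<close>

lemma rho_lin_tetrahedron:
  assumes "distinct [i, j, k, l]"
  shows "rho_lin i j k (rho_lin i j l (rho_lin i k l (rho_lin j k l v)))
       = rho_lin j k l (rho_lin i k l (rho_lin i j l (rho_lin i j k v)))"
proof -
  define E where "E p q \<longleftrightarrow>
    rho_lin i j k (rho_lin i j l (rho_lin i k l (rho_lin j k l (x_vec p q))))
      = rho_lin j k l (rho_lin i k l (rho_lin i j l (rho_lin i j k (x_vec p q))))" for p q
  note action = rho_lin_triple_basis rho_lin_fixes rho_lin_fixes_diagonal
    linear_extension_add linear_extension_scale
  have "E i k" "E i l" "E j i" "E j l" "E k i" "E k l" "E l i" "E l j"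
    "E i i" "E j j" "E k k" "E l l"
    unfolding E_def using assms by (simp_all add: action)
  \<comment> \<open>Here the two sides agree only after comparing coefficients. For
    \<open>x_jk\<close> and \<open>x_kj\<close> this is commutativity of the variables; for
    \<open>x_ij\<close> and \<open>x_lk\<close> it is
    \<open>u * (1 - u) + (1 - u)^2 = 1 - u\<close>, with \<open>u\<close> equal to
    \<open>t_i\<close> or to the inverse of \<open>t_l\<close>.\<close>
  moreover have "E i j" "E j k" "E k j" "E l k"
    unfolding E_def using assms
    by (simp_all add: action) (rule poly_mapping_eqI, simp add: lookup_add algebra_simps)+
  moreover have "E p q" if "p \<notin> {i, j, k, l} \<or> q \<notin> {i, j, k, l}" for p q
    unfolding E_def using that by (elim disjE) (simp_all add: rho_lin_fixes)
  ultimately have "E p q" for p q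
    by (metis insert_iff empty_iff)
  then have "rho_lin i j k (rho_lin i j l (rho_lin i k l (rho_on_basis j k l b)))
      = rho_lin j k l (rho_lin i k l (rho_lin i j l (rho_on_basis i j k b)))" for b
    unfolding E_def by (cases b) (simp add: linear_extension_basis)
  then show ?thesis
    by (simp add: linear_extension_compose)
qed

section \<open>Automorphisms of V and the representation\<close>

lemma rho_closed:
  assumes "(i, j, k) \<in> G3_gens n" "v \<in> carrier (V_module n)"
  shows "rho_lin i j k v \<in> carrier (V_module n)"
proof -
  have "rho n i j k v \<in> carrier (V_module n)"
    using rho_in_End[OF assms(1)] assms(2) by (auto simp: module_End_def)
  then show ?thesis
    using assms(2) by (simp add: rho_def)
qed

lemma G3_gens_rev: "(i, j, k) \<in> G3_gens n \<Longrightarrow> (k, j, i) \<in> G3_gens n"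
  by (auto simp: G3_gens_def)

lemma rho_in_module_Aut:
  assumes "(i, j, k) \<in> G3_gens n"
  shows "rho n i j k \<in> carrier (module_Aut (A_ring n) (V_module n))"
proof -
  have "distinct [i, j, k]" "distinct [k, j, i]"
    using assms by (auto simp: G3_gens_def)
  then have "bij_betw (rho n i j k) (carrier (V_module n)) (carrier (V_module n))"
    using assms
    \<comment> \<open>The reversed triple gives a two-sided inverse: \<open>rho_lin_inverse\<close>
      is applied to \<open>(i, j, k)\<close> and to \<open>(k, j, i)\<close>.\<close>
    by (intro bij_betw_byWitness[where f' = "rho n k j i"])
       (auto simp: rho_def rho_closed G3_gens_rev rho_lin_inverse)
  then show ?thesis
    using rho_in_End[OF assms] by (auto simp: carrier_module_Aut Bij_def rho_def)
qed

theorem theorem1: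
  fixes n :: nat
  assumes "n > 0"
  shows "\<exists>\<rho>. group_hom (G3_hat n) (module_Aut (A_ring n) (V_module n)) \<rho> \<and>
    (\<forall>i\<in>{1..n}. \<forall>j\<in>{1..n}. \<forall>k\<in>{1..n}. distinct [i, j, k] \<longrightarrow>
      \<rho> (G3_gen n (i, j, k)) = rho n i j k)"
proof -
  let ?H = "module_Aut (A_ring n) (V_module n)"
  let ?V = "carrier (V_module n)"
  interpret M: module "A_ring n" "V_module n"
    unfolding A_ring_def V_module_def by (rule module_free_module)
  interpret H: group ?H
    by (rule M.group_module_Aut)
  define f where "f = (\<lambda>(i, j, k). rho n i j k)"
  have f: "f \<in> G3_gens n \<rightarrow> carrier ?H"
    by (auto simp: f_def rho_in_module_Aut)
  have mult: "g \<otimes>\<^bsub>?H\<^esub> h = compose ?V g h" if "g \<in> carrier ?H" "h \<in> carrier ?H" for g h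
    using that by (intro mult_module_Aut) (auto simp: carrier_module_Aut)
  have apply_mult: "(g \<otimes>\<^bsub>?H\<^esub> h) v = g (h v)" if "g \<in> carrier ?H" "h \<in> carrier ?H" "v \<in> ?V" for g h v
    using that by (simp add: mult compose_eq)
  \<comment> \<open>Elements of the automorphism group are extensional, so relations in it may be
    tested pointwise on V.\<close>
  have eqI: "g = h" if "g \<in> carrier ?H" "h \<in> carrier ?H" "\<And>v. v \<in> ?V \<Longrightarrow> g v = h v" for g h
    using that by (auto simp: carrier_module_Aut Bij_def intro: extensionalityI)
  have one_apply: "\<one>\<^bsub>?H\<^esub> v = v" if "v \<in> ?V" for v
    using that by (simp add: one_module_Aut)
  have rho: "rho n i j k v = rho_lin i j k v" if "v \<in> ?V" for i j k v
    using that by (simp add: rho_def)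
  have "word_eval ?H f u = word_eval ?H f v" if "(u, v) \<in> G3_rels n" for u v
    using that unfolding G3_rels_def
  proof (elim UnE CollectE exE conjE)
    fix i j k
    assume uv: "(u, v) = ([((k, j, i), True)], [((i, j, k), False)])" and g: "(i, j, k) \<in> G3_gens n"
    note A = rho_in_module_Aut[OF g] rho_in_module_Aut[OF G3_gens_rev[OF g]]
    \<comment> \<open>In a group a left inverse is already the inverse, so one composite
      suffices.\<close>
    have "rho n k j i \<otimes>\<^bsub>?H\<^esub> rho n i j k = \<one>\<^bsub>?H\<^esub>"
      using A g by (intro eqI)
        (auto simp: apply_mult rho rho_closed one_apply rho_lin_inverse G3_gens_def)
    then have "rho n k j i = inv\<^bsub>?H\<^esub> rho n i j k"
      using A by (intro H.inv_equality[symmetric]) auto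
    then show ?thesis
      using uv A by (simp add: f_def)
  next
    fix i j k p q r
    assume uv: "(u, v) = ([((i, j, k), True), ((p, q, r), True)], [((p, q, r), True), ((i, j, k), True)])"
      and g: "(i, j, k) \<in> G3_gens n" "(p, q, r) \<in> G3_gens n" and card: "5 \<le> card {i, j, k, p, q, r}"
    note A = g[THEN rho_in_module_Aut]
    have "distinct [i, j, k]" "distinct [p, q, r]"
      using g by (auto simp: G3_gens_def)
    note commute = rho_lin_commute[OF this card]
    have "rho n i j k \<otimes>\<^bsub>?H\<^esub> rho n p q r = rho n p q r \<otimes>\<^bsub>?H\<^esub> rho n i j k"
      using A g by (intro eqI) (simp_all add: apply_mult rho rho_closed commute)
    then show ?thesis
      using uv A by (simp add: f_def)
  next
    fix i j k l
    assume uv: "(u, v) = ([((i, j, k), True), ((i, j, l), True), ((i, k, l), True), ((j, k, l), True)],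
        [((j, k, l), True), ((i, k, l), True), ((i, j, l), True), ((i, j, k), True)])"
      and ijkl: "{i, j, k, l} \<subseteq> {1..n}" "distinct [i, j, k, l]"
    have g: "(i, j, k) \<in> G3_gens n" "(i, j, l) \<in> G3_gens n" "(i, k, l) \<in> G3_gens n" "(j, k, l) \<in> G3_gens n"
      using ijkl by (auto simp: G3_gens_def)
    note A = g[THEN rho_in_module_Aut]
    \<comment> \<open>The brackets are nested to the right, as \<open>word_eval\<close> produces
      them.\<close>
    have "rho n i j k \<otimes>\<^bsub>?H\<^esub> (rho n i j l \<otimes>\<^bsub>?H\<^esub> (rho n i k l \<otimes>\<^bsub>?H\<^esub> rho n j k l))
        = rho n j k l \<otimes>\<^bsub>?H\<^esub> (rho n i k l \<otimes>\<^bsub>?H\<^esub> (rho n i j l \<otimes>\<^bsub>?H\<^esub> rho n i j k))"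
      using A g by (intro eqI) (simp_all add: apply_mult rho rho_closed rho_lin_tetrahedron[OF ijkl(2)])
    then show ?thesis
      using uv A by (simp add: f_def)
  qed
  from H.presented_group_universal[OF f this]
  obtain \<phi> where hom: "group_hom (G3_hat n) ?H \<phi>"
    and gen: "\<And>g. g \<in> G3_gens n \<Longrightarrow> \<phi> (G3_gen n g) = f g"
    unfolding G3_hat_def G3_gen_def by blast
  have "\<phi> (G3_gen n (i, j, k)) = rho n i j k"
    if "i \<in> {1..n}" "j \<in> {1..n}" "k \<in> {1..n}" "distinct [i, j, k]" for i j k
  proof -
    have "(i, j, k) \<in> G3_gens n"
      using that by (simp add: G3_gens_def)
    from gen[OF this] show ?thesis by (simp add: f_def)
  qed
  with hom show ?thesis by blast
qed

end
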